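(* Let $k,l,s$ be positive integers with $k\geq 4$ and $s\geq kl$, and let $c(k,s)>0$ be a constant such that every family $\mathcal{G}\subseteq\binom{[n]}{k}$ (for every $n$) contains a $(k,s)$-homogeneous subfamily $\mathcal{G}^*$ with $|\mathcal{G}^*|\geq c(k,s)|\mathcal{G}|$. Let $\mathcal{F}\subseteq\binom{[n]}{k}$ and suppose $\mathcal{F}$ contains no copy of $\mathbb{P}^{(k)}_l$. Then $\mathcal{F}$ can be partitioned into subfamilies $\mathcal{G}_1,\ldots,\mathcal{G}_m,\mathcal{F}_0$ (for some $m\ge 0$) such that for every $i\in[m]$, $\mathcal{G}_i$ is $(k,s)$-homogeneous with an intersection pattern $\mathcal{J}_i$ that has rank $k-1$ and is of type 1, and $|\mathcal{F}_0|\leq\frac{1}{c(k,s)}\binom{n}{k-2}$.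
   Context: A family $\mathcal{F}\subseteq\binom{[n]}{k}$ is $k$-partite with $k$-partition $(X_1,\ldots,X_k)$ if $X_1,\ldots,X_k$ partition $[n]$ and $|F\cap X_i|=1$ for all $F\in\mathcal{F}$, $i\in[k]$. For $S\subseteq[n]$ its pattern is $\Pi(S)=\{i: S\cap X_i\neq\emptyset\}$, and $\Pi(\mathcal{L})=\{\Pi(S):S\in\mathcal{L}\}$. For $F\in\mathcal{F}$, $\mathcal{I}(F,\mathcal{F})=\{F\cap F': F'\in\mathcal{F},F'\neq F\}$. An $s$-star with kernel $A$ is a family of sets $F_1,\ldots,F_s$ with $F_i\cap F_j=A$ for all $i<j$. A family $\mathcal{F}^*\subseteq\binom{[n]}{k}$ is $(k,s)$-homogeneous with intersection pattern $\mathcal{J}$ if: $\mathcal{F}^*$ is $k$-partite with a $k$-partition $(X_1,\ldots,X_k)$; $\mathcal{J}$ is a family of proper subsets of $[k]$ with $\Pi(\mathcal{I}(F,\mathcal{F}^* ))=\mathcal{J}$ for all $F\in\mathcal{F}^*$; $\mathcal{J}$ is closed under intersection; and for every $F\in\mathcal{F}^*$ and every $A\in\mathcal{I}(F,\mathcal{F}^* )$ there is an $s$-star in $\mathcal{F}^*$ containing $F$ with kernel $A$. (By Füredi's intersection semilattice lemma, a constant $c(k,s)>0$ as in the claim exists.) The rank of a family $\mathcal{L}$ of subsets of $[k]$ is $r(\mathcal{L})=\min\{|D|: D\subseteq[k],\ \text{no } B\in\mathcal{L}\text{ satisfies } D\subseteq B\}$. A family $\mathcal{L}$ of rank $k-1$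 is of type 1 if there is $x\in[k]$ with $[k]\setminus\{x\}\notin\mathcal{L}$ but $[k]\setminus\{y\}\in\mathcal{L}$ for all $y\neq x$. A $k$-uniform linear path of length $l$, $\mathbb{P}^{(k)}_l$, is a family of $k$-sets $\{F_1,\ldots,F_l\}$ with $|F_i\cap F_{i+1}|=1$ for each $i$ and $F_i\cap F_j=\emptyset$ whenever $|i-j|>1$; a family contains a copy of it if some subfamily is isomorphic to it. *)

theory Defs
  imports Complex_Main "HOL-Library.Disjoint_Sets" "HOL-Library.Ramsey"
begin

text \<open>The ground set \<open>[n]\<close> is \<^term>\<open>{1..n}\<close>, and the family of its \<open>k\<close>-subsets is
  \<^term>\<open>nsets {1..n} k\<close>.  A \<open>k\<close>-partition is a function \<open>X\<close>, relevant only on \<^term>\<open>{1..k}\<close>.\<close>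

text \<open>Parts may be empty: for \<open>n < k\<close> the only \<open>k\<close>-uniform family on \<open>[n]\<close> is the empty one,
  and it has to count as \<open>k\<close>-partite (a homogeneous subfamily of it is supposed to exist).
  If \<open>\<F>\<close> is nonempty, all parts are nonempty automatically.\<close>

definition k_partite :: "nat \<Rightarrow> nat \<Rightarrow> (nat \<Rightarrow> nat set) \<Rightarrow> nat set set \<Rightarrow> bool" where
  "k_partite n k X \<F> \<longleftrightarrow>
     \<F> \<subseteq> nsets {1..n} k \<and>
     disjoint_family_on X {1..k} \<and> (\<Union>i\<in>{1..k}. X i) = {1..n} \<and>
     (\<forall>F\<in>\<F>. \<forall>i\<in>{1..k}. card (F \<inter> X i) = 1)"

definition pattern :: "nat \<Rightarrow> (nat \<Rightarrow> nat set) \<Rightarrow> nat set \<Rightarrow> nat set" where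
  "pattern k X S = {i \<in> {1..k}. S \<inter> X i \<noteq> {}}"

definition intersections :: "'a set \<Rightarrow> 'a set set \<Rightarrow> 'a set set" where
  "intersections F \<F> = {F \<inter> F' | F'. F' \<in> \<F> \<and> F' \<noteq> F}"

definition star :: "nat \<Rightarrow> 'a set \<Rightarrow> 'a set set \<Rightarrow> bool" where
  "star s A \<S> \<longleftrightarrow> finite \<S> \<and> card \<S> = s \<and> pairwise (\<lambda>F F'. F \<inter> F' = A) \<S>"

definition homogeneous ::
    "nat \<Rightarrow> nat \<Rightarrow> nat \<Rightarrow> nat set set \<Rightarrow> nat set set \<Rightarrow> bool" where
  "homogeneous n k s \<F> \<J> \<longleftrightarrow>
     (\<exists>X. k_partite n k X \<F> \<and>
        (\<forall>B\<in>\<J>. B \<subset> {1..k}) \<and>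
        (\<forall>F\<in>\<F>. pattern k X ` intersections F \<F> = \<J>) \<and>
        (\<forall>A\<in>\<J>. \<forall>B\<in>\<J>. A \<inter> B \<in> \<J>) \<and>
        (\<forall>F\<in>\<F>. \<forall>A\<in>intersections F \<F>. \<exists>\<S>\<subseteq>\<F>. F \<in> \<S> \<and> star s A \<S>))"

text \<open>The minimum is over a nonempty set whenever \<^term>\<open>{1..k} \<notin> \<L>\<close>, in particular for
  families of proper subsets.\<close>

definition rank :: "nat \<Rightarrow> nat set set \<Rightarrow> nat" where
  "rank k \<L> = Min {card D | D. D \<subseteq> {1..k} \<and> \<not> (\<exists>B\<in>\<L>. D \<subseteq> B)}"

definition type1 :: "nat \<Rightarrow> nat set set \<Rightarrow> bool" where
  "type1 k \<L> \<longleftrightarrow> rank k \<L> = k - 1 \<and>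
     (\<exists>x\<in>{1..k}. {1..k} - {x} \<notin> \<L> \<and> (\<forall>y\<in>{1..k}. y \<noteq> x \<longrightarrow> {1..k} - {y} \<in> \<L>))"

definition linear_path :: "nat \<Rightarrow> nat \<Rightarrow> 'a set set \<Rightarrow> bool" where
  "linear_path k l \<P> \<longleftrightarrow>
     (\<exists>F :: nat \<Rightarrow> 'a set. \<P> = F ` {1..l} \<and>
        (\<forall>i\<in>{1..l}. finite (F i) \<and> card (F i) = k) \<and>
        (\<forall>i. 1 \<le> i \<and> i + 1 \<le> l \<longrightarrow> card (F i \<inter> F (i + 1)) = 1) \<and>
        (\<forall>i\<in>{1..l}. \<forall>j\<in>{1..l}. i + 1 < j \<longrightarrow> F i \<inter> F j = {}))"

definition isomorphic :: "'a set set \<Rightarrow> 'b set set \<Rightarrow> bool" where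
  "isomorphic \<A> \<B> \<longleftrightarrow> (\<exists>f. bij_betw f (\<Union>\<A>) (\<Union>\<B>) \<and> (`) f ` \<A> = \<B>)"

definition contains_copy :: "'a set set \<Rightarrow> 'b set set \<Rightarrow> bool" where
  "contains_copy \<F> \<H> \<longleftrightarrow> (\<exists>\<S>\<subseteq>\<F>. isomorphic \<S> \<H>)"

end

(* Homogeneous subfamilies are removed greedily, stopping as soon as the one found is not of
   type 1.  If its intersection pattern has rank at most k - 2, every member is determined by its
   trace on k - 2 parts, so what is left has at most binom(n, k - 2) / c members.  Otherwise every
   (k-2)-subset of [k] is covered by the pattern; failure of type 1 and closure under intersection
   then put two distinct singletons {i}, {j} into the pattern, and a linear path can be grown
   through large stars whose kernels lie alternately in the parts X i and X j. *)
theory Submission imports Defs begin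

section \<open>Linear paths grown through stars\<close>

text \<open>Two members of the star share only points of \<open>A\<close>, and \<open>A\<close>
  misses \<open>U\<close>, so each point of \<open>U\<close> lies in at most one member. Fewer than
  \<open>s - 1\<close> points therefore cannot block all \<open>s - 1\<close> members other than
  \<open>F\<close>.\<close>

lemma star_member_avoiding:
  assumes S: "star s A \<S>" and F: "F \<in> \<S>"
    and U: "finite U" "U \<inter> A = {}" "card U + 1 < s"
  shows "\<exists>F'\<in>\<S>. F' \<noteq> F \<and> F' \<inter> F = A \<and> F' \<inter> U = {}"
proof (rule ccontr)
  have fin: "finite \<S>" "card \<S> = s" and pw: "pairwise (\<lambda>F F'. F \<inter> F' = A) \<S>"
    using S by (auto simp: star_def)
  assume "\<not> ?thesis"
  moreover have "F' \<inter> F = A" if "F' \<in> \<S> - {F}" for F'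
    using pairwiseD[OF pw, of F' F] that F by simp
  ultimately have "\<forall>F'\<in>\<S> - {F}. \<exists>u. u \<in> F' \<inter> U"
    by blast
  then obtain u where u: "\<And>F'. F' \<in> \<S> - {F} \<Longrightarrow> u F' \<in> F' \<inter> U"
    by metis
  have "inj_on u (\<S> - {F})"
  proof (rule inj_onI, rule ccontr)
    fix P Q assume PQ: "P \<in> \<S> - {F}" "Q \<in> \<S> - {F}" "u P = u Q" "P \<noteq> Q"
    then have "P \<inter> Q = A"
      using pw by (auto simp: pairwise_def)
    with u[OF PQ(1)] u[OF PQ(2)] PQ(3) U(2) show False by auto
  qed
  then have "card (\<S> - {F}) \<le> card U"
    using u U(1) by (intro card_inj_on_le[of u]) auto
  with fin F U(3) show False by simp
qed

text \<open>Induction on the number \<open>m\<close> of edges, with the invariant that the last edge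
  has its vertex in \<open>X p\<close> (\<open>p\<close> being \<open>i\<close> or \<open>j\<close>)
  outside all earlier edges. That vertex is the kernel of a star from which the next edge is taken;
  the roles of \<open>i\<close> and \<open>j\<close> then alternate.\<close>

lemma linear_path_if_stars:
  assumes G: "\<And>F. F \<in> \<G> \<Longrightarrow> finite F \<and> card F = k" and ne: "\<G> \<noteq> {}"
    and disj: "X i \<inter> X j = {}"
    and one: "\<And>F p. F \<in> \<G> \<Longrightarrow> p \<in> {i, j} \<Longrightarrow> card (F \<inter> X p) = 1"
    and stars: "\<And>F p. F \<in> \<G> \<Longrightarrow> p \<in> {i, j} \<Longrightarrow> \<exists>\<S>\<subseteq>\<G>. F \<in> \<S> \<and> star s (F \<inter> X p) \<S>"
    and "k \<ge> 1" "l \<ge> 1" "s \<ge> k * l"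
  shows "\<exists>\<P>\<subseteq>\<G>. linear_path k l \<P>"
proof -
  have "\<exists>F p. (\<forall>t\<in>{1..m}. F t \<in> \<G>) \<and>
      (\<forall>t. 1 \<le> t \<and> t + 1 \<le> m \<longrightarrow> card (F t \<inter> F (t + 1)) = 1) \<and>
      (\<forall>t\<in>{1..m}. \<forall>t'\<in>{1..m}. t + 1 < t' \<longrightarrow> F t \<inter> F t' = {}) \<and>
      p \<in> {i, j} \<and> F m \<inter> X p \<inter> (\<Union>t\<in>{1..<m}. F t) = {}"
    if "1 \<le> m" "m \<le> l" for m
    using that
  proof (induction m rule: nat_induct_at_least)
    case base
    obtain F where "F \<in> \<G>" using ne by auto
    then show ?case
      by (intro exI[of _ "\<lambda>_. F"] exI[of _ i]) auto
  next
    case (Suc m)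
    from Suc.IH[OF Suc_leD[OF Suc.prems]]
    obtain F p where F0: "\<forall>t\<in>{1..m}. F t \<in> \<G>"
      and adj0: "\<forall>t. 1 \<le> t \<and> t + 1 \<le> m \<longrightarrow> card (F t \<inter> F (t + 1)) = 1"
      and far0: "\<forall>t\<in>{1..m}. \<forall>t'\<in>{1..m}. t + 1 < t' \<longrightarrow> F t \<inter> F t' = {}"
      and p: "p \<in> {i, j}" "F m \<inter> X p \<inter> (\<Union>t\<in>{1..<m}. F t) = {}"
      by (elim exE conjE) (rule that)
    note F = F0[rule_format] and adj = adj0[rule_format] and far = far0[rule_format]
    \<comment> \<open>The new edge has to avoid \<open>U\<close>, but not \<open>F m\<close>, which
      it must meet in the kernel.\<close>
    define U where "U = (\<Union>t\<in>{1..<m}. F t)"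
    have Fm: "F m \<in> \<G>" using F Suc.hyps by simp
    obtain \<S> where S: "\<S> \<subseteq> \<G>" "F m \<in> \<S>" "star s (F m \<inter> X p) \<S>"
      using stars[OF Fm p(1)] by auto
    have finU: "finite U"
      using F G by (auto simp: U_def)
    have "card U \<le> (\<Sum>t\<in>{1..<m}. card (F t))"
      unfolding U_def by (rule card_UN_le) simp
    also have "\<dots> = (\<Sum>t\<in>{1..<m}. k)"
      using F G by (intro sum.cong) auto
    finally have "card U \<le> (m - 1) * k" by simp
    moreover have "(m - 1) * k + 1 < s"
    proof -
      \<comment> \<open>As \<open>Suc m\<close> is at most \<open>l\<close>, the bound
        \<open>s \<ge> k * l\<close> leaves room for \<open>2 * k\<close>, hence at least 2, points
        beyond \<open>(m - 1) * k\<close>.\<close>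
      have "(m - 1) * k + 2 * k = (m + 1) * k"
        using Suc.hyps by (simp add: add_mult_distrib[symmetric])
      also have "\<dots> \<le> l * k" using Suc.prems by (intro mult_le_mono) auto
      also have "\<dots> \<le> s" using \<open>s \<ge> k * l\<close> by (simp add: mult.commute)
      finally show ?thesis using \<open>k \<ge> 1\<close> by linarith
    qed
    ultimately have "card U + 1 < s" by linarith
    then obtain H where H: "H \<in> \<S>" "H \<inter> F m = F m \<inter> X p" "H \<inter> U = {}"
      using star_member_avoiding[OF S(3,2) finU] p(2) U_def by blast
    define q where "q = (if p = i then j else i)"
    have pq: "X p \<inter> X q = {}" "q \<in> {i, j}"
      using p(1) disj by (auto simp: q_def)
    \<comment> \<open>\<open>H\<close> meets \<open>F m\<close> only inside \<open>X p\<close>, so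
      its vertex in the other part is new: this restores the invariant.\<close>
    have "H \<inter> X q \<inter> F m = {}"
      using H(2) pq by auto
    moreover have "(\<Union>t\<in>{1..<Suc m}. F t) = F m \<union> U"
      using Suc.hyps by (auto simp: U_def less_Suc_eq)
    ultimately have free: "H \<inter> X q \<inter> (\<Union>t\<in>{1..<Suc m}. F t) = {}"
      using H(3) by auto
    have cardH: "card (F m \<inter> H) = 1"
      using H(2) one[OF Fm p(1)] by (simp add: Int_commute)
    have farH: "F t \<inter> H = {}" if "t \<in> {1..<m}" for t
      using H(3) that unfolding U_def by blast
    let ?F = "F(Suc m := H)"
    have n1: "?F t \<in> \<G>" if "t \<in> {1..Suc m}" for t
      using that F H(1) S(1) by (auto simp: le_Suc_eq)
    have n2: "card (?F t \<inter> ?F (t + 1)) = 1" if "1 \<le> t \<and> t + 1 \<le> Suc m" for t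
      using that adj[of t] cardH by (cases "t = m") auto
    have n3: "?F t \<inter> ?F t' = {}"
      if "t \<in> {1..Suc m}" "t' \<in> {1..Suc m}" "t + 1 < t'" for t t'
      using that far[of t t'] farH[of t] by (cases "t' = Suc m") auto
    have n4: "?F (Suc m) \<inter> X q \<inter> (\<Union>t\<in>{1..<Suc m}. ?F t) = {}"
      using free by auto
    show ?case
      by (intro exI[of _ ?F] exI[of _ q] conjI ballI allI impI)
        (rule n1 n2 n3 n4 pq(2); assumption)+
  qed
  from this[OF \<open>l \<ge> 1\<close> order_refl]
  obtain F where F: "\<forall>t\<in>{1..l}. F t \<in> \<G>"
    and "\<forall>t. 1 \<le> t \<and> t + 1 \<le> l \<longrightarrow> card (F t \<inter> F (t + 1)) = 1"
    and "\<forall>t\<in>{1..l}. \<forall>t'\<in>{1..l}. t + 1 < t' \<longrightarrow> F t \<inter> F t' = {}"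
    by (elim exE conjE) (rule that)
  then have "linear_path k l (F ` {1..l})"
    using G unfolding linear_path_def by blast
  with F show ?thesis by (intro exI[of _ "F ` {1..l}"]) auto
qed

lemma contains_copy_subset:
  assumes "\<P> \<subseteq> \<F>"
  shows "contains_copy \<F> \<P>"
  unfolding contains_copy_def isomorphic_def
  using assms by (intro exI[of _ \<P>] conjI exI[of _ id]) auto

section \<open>Singletons in intersection-closed families\<close>

lemma Inter_closed_mem:
  assumes "finite \<B>" "\<B> \<noteq> {}" "\<B> \<subseteq> \<J>" "\<And>A B. A \<in> \<J> \<Longrightarrow> B \<in> \<J> \<Longrightarrow> A \<inter> B \<in> \<J>"
  shows "\<Inter>\<B> \<in> \<J>"
  using assms(1-3) by (induction \<B> rule: finite_ne_induct) (auto intro: assms(4))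

text \<open>The intersection of all members containing \<open>i\<close> is again a member, and
  separation removes every other point of \<open>K\<close> from it. Since \<open>K\<close> has a
  second point, at least one member contains \<open>i\<close>, so the intersection is not taken over
  the empty family.\<close>

lemma singleton_mem_if_separated:
  assumes "finite K" "i \<in> K" "K \<noteq> {i}"
    and sub: "\<And>B. B \<in> \<J> \<Longrightarrow> B \<subseteq> K"
    and cl: "\<And>A B. A \<in> \<J> \<Longrightarrow> B \<in> \<J> \<Longrightarrow> A \<inter> B \<in> \<J>"
    and sep: "\<And>y. y \<in> K \<Longrightarrow> y \<noteq> i \<Longrightarrow> \<exists>B\<in>\<J>. i \<in> B \<and> y \<notin> B"
  shows "{i} \<in> \<J>"
proof -
  let ?\<B> = "{B \<in> \<J>. i \<in> B}"
  have fin: "finite ?\<B>"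
    by (rule finite_subset[of _ "Pow K"]) (use sub \<open>finite K\<close> in auto)
  obtain y where "y \<in> K" "y \<noteq> i" using assms(2,3) by auto
  with sep have ne: "?\<B> \<noteq> {}" by blast
  have "\<Inter>?\<B> \<subseteq> {i}"
    using ne sub sep by blast
  then have "\<Inter>?\<B> = {i}" by blast
  with Inter_closed_mem[of ?\<B> \<J>] fin ne cl show ?thesis by auto
qed

text \<open>Let \<open>M\<close> be the set of points whose complement is missing from
  \<open>\<J>\<close>; \<open>not1\<close> says that \<open>M\<close> does not have exactly one
  element. A point \<open>i\<close> can be separated from all others by complements of points
  outside \<open>M\<close> and of pairs inside \<open>M\<close>, unless \<open>M - {i}\<close> is a
  singleton. At least two points \<open>i\<close> escape this exception.\<close>

lemma two_singletons_if_not_type1: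
  assumes "k \<ge> 4"
    and proper: "\<And>B. B \<in> \<J> \<Longrightarrow> B \<subset> {1..k}"
    and cl: "\<And>A B. A \<in> \<J> \<Longrightarrow> B \<in> \<J> \<Longrightarrow> A \<inter> B \<in> \<J>"
    and cov: "\<And>D. D \<subseteq> {1..k} \<Longrightarrow> card D = k - 2 \<Longrightarrow> \<exists>B\<in>\<J>. D \<subseteq> B"
    and not1: "\<And>x. x \<in> {1..k} \<Longrightarrow> {1..k} - {x} \<notin> \<J> \<Longrightarrow>
      \<exists>y\<in>{1..k}. y \<noteq> x \<and> {1..k} - {y} \<notin> \<J>"
  shows "\<exists>i\<in>{1..k}. \<exists>j\<in>{1..k}. i \<noteq> j \<and> {i} \<in> \<J> \<and> {j} \<in> \<J>"
proof -
  define M where "M = {x \<in> {1..k}. {1..k} - {x} \<notin> \<J>}"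
  have pair: "{1..k} - {x, y} \<in> \<J>" if "x \<in> M" "y \<in> M" "x \<noteq> y" for x y
  proof -
    have xy: "x \<in> {1..k}" "y \<in> {1..k}" using that by (auto simp: M_def)
    then have "card ({1..k} - {x, y}) = k - 2"
      using \<open>x \<noteq> y\<close> by (subst card_Diff_subset) auto
    \<comment> \<open>A proper subset covering this set is the set itself or the complement of
      \<open>x\<close> or of \<open>y\<close>; the last two are missing by the definition of
      \<open>M\<close>.\<close>
    then obtain B where B: "B \<in> \<J>" "{1..k} - {x, y} \<subseteq> B" using cov by blast
    have "B = {1..k} - {x, y} \<or> B = {1..k} - {x} \<or> B = {1..k} - {y}"
      using B(2) proper[OF B(1)] xy by blast
    with B(1) that show ?thesis by (auto simp: M_def)
  qed
  have single: "{i} \<in> \<J>" if i: "i \<in> {1..k}" "\<And>y. M - {i} \<noteq> {y}" for i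
  proof (rule singleton_mem_if_separated[of "{1..k}"])
    have "card {1..k} \<noteq> card {i}" using \<open>k \<ge> 4\<close> by simp
    then show "{1..k} \<noteq> {i}" by metis
    fix y assume y: "y \<in> {1..k}" "y \<noteq> i"
    show "\<exists>B\<in>\<J>. i \<in> B \<and> y \<notin> B"
    proof (cases "y \<in> M")
      case True
      \<comment> \<open>Here the complement of \<open>y\<close> is missing, so a second point
        \<open>z\<close> of \<open>M\<close>, different from \<open>i\<close>, is removed along with
        \<open>y\<close>.\<close>
      with i(2)[of y] y obtain z where "z \<in> M" "z \<noteq> i" "z \<noteq> y" by blast
      with pair[of y z] True y i show ?thesis
        by (intro bexI[of _ "{1..k} - {y, z}"]) auto
    next
      case False
      with y i show ?thesis
        by (intro bexI[of _ "{1..k} - {y}"]) (auto simp: M_def)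
    qed
  qed (use i proper cl in auto)
  have "\<exists>T\<subseteq>{1..k}. card T = 2 \<and> (\<forall>i\<in>T. \<forall>y. M - {i} \<noteq> {y})"
  proof (cases "card M = 2")
    case True
    \<comment> \<open>If \<open>M\<close> has two elements, removing one of them leaves a singleton,
      so both singletons are sought outside \<open>M\<close>; \<open>k \<ge> 4\<close> provides two
      points there.\<close>
    have "card ({1..k} - M) = k - 2"
      using True by (subst card_Diff_subset) (auto simp: M_def)
    with \<open>k \<ge> 4\<close> have "2 \<le> card ({1..k} - M)" by simp
    then obtain T where "T \<subseteq> {1..k} - M" "card T = 2"
      by (rule obtain_subset_with_card_n)
    moreover have "M \<noteq> {y}" for y using True by auto
    ultimately show ?thesis by (intro exI[of _ T]) auto
  next
    case False
    \<comment> \<open>A singleton \<open>M - {i}\<close> would force \<open>M\<close> to have one or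
      two elements, and both sizes are excluded. Any two points then serve, for instance 1 and
      2.\<close>
    have "M - {i} \<noteq> {y}" for i y
    proof
      assume *: "M - {i} = {y}"
      then have y: "y \<in> M" by auto
      then obtain z where "z \<in> M" "z \<noteq> y" using not1[of y] by (auto simp: M_def)
      with * have "M = {i, y}" "i \<noteq> y" by auto
      with False show False by simp
    qed
    with \<open>k \<ge> 4\<close> show ?thesis by (intro exI[of _ "{1, 2}"]) auto
  qed
  then obtain T where T: "T \<subseteq> {1..k}" "card T = 2" "\<forall>i\<in>T. \<forall>y. M - {i} \<noteq> {y}"
    by (elim exE conjE)
  have "{i} \<in> \<J>" if "i \<in> T" for i
    by (rule single[OF subsetD[OF T(1) that] T(3)[rule_format, OF that]])
  moreover obtain i j where "T = {i, j}" "i \<noteq> j"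
    using T(2) by (auto simp: card_2_iff)
  ultimately show ?thesis
    using T(1) by blast
qed

section \<open>Intersection patterns of homogeneous families\<close>

text \<open>The intersection is a nonempty subset of the one-point set
  \<open>F \<inter> X i\<close>. This turns a singleton in the pattern into a star kernel of the
  shape that the path construction requires.\<close>

lemma pattern_singleton_Int:
  assumes part: "k_partite n k X \<G>" and "F \<in> \<G>" and "i \<in> {1..k}"
    and pat: "pattern k X (F \<inter> F') = {i}"
  shows "F \<inter> F' = F \<inter> X i"
proof -
  have "F \<subseteq> (\<Union>j\<in>{1..k}. X j)"
    using part \<open>F \<in> \<G>\<close> by (auto simp: k_partite_def nsets_def)
  moreover have "F \<inter> F' \<inter> X j = {}" if "j \<in> {1..k}" "j \<noteq> i" for j
    using pat that by (auto simp: pattern_def)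
  ultimately have sub: "F \<inter> F' \<subseteq> X i" by blast
  have "card (F \<inter> X i) = 1"
    using part \<open>F \<in> \<G>\<close> \<open>i \<in> {1..k}\<close> by (simp add: k_partite_def)
  then obtain v where "F \<inter> X i = {v}"
    by (rule card_1_singletonE)
  moreover have "F \<inter> F' \<inter> X i \<noteq> {}"
    using pat by (auto simp: pattern_def)
  moreover have "F \<inter> F' \<inter> X i = F \<inter> F'" "F \<inter> F' \<subseteq> F \<inter> X i"
    using sub by auto
  ultimately show ?thesis by (simp add: subset_singleton_iff)
qed

text \<open>Two members with the same trace on the parts indexed by \<open>D\<close> would share a
  vertex in each of these parts, so the pattern of their intersection would cover \<open>D\<close>.
  Hence the trace, a set of \<open>card D\<close> vertices, determines the member.\<close>

lemma card_le_if_uncovered: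
  assumes part: "k_partite n k X \<G>" and D: "D \<subseteq> {1..k}"
    and unc: "\<And>F B. F \<in> \<G> \<Longrightarrow> B \<in> pattern k X ` intersections F \<G> \<Longrightarrow> \<not> D \<subseteq> B"
  shows "card \<G> \<le> n choose card D"
proof -
  let ?t = "\<lambda>F. F \<inter> (\<Union>i\<in>D. X i)"
  have "finite D" using D finite_subset by blast
  have one: "card (F \<inter> X i) = 1" if "F \<in> \<G>" "i \<in> D" for F i
    using part that D by (auto simp: k_partite_def)
  have "inj_on ?t \<G>"
  proof (rule inj_onI, rule ccontr)
    fix F F' assume F: "F \<in> \<G>" "F' \<in> \<G>" "?t F = ?t F'" "F \<noteq> F'"
    have "F \<inter> F' \<inter> X i \<noteq> {}" if "i \<in> D" for i
    proof -
      have "F \<inter> X i \<noteq> {}" using one[OF F(1) that] by auto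
      with F(3) that show ?thesis by blast
    qed
    then have "D \<subseteq> pattern k X (F \<inter> F')" using D by (auto simp: pattern_def)
    moreover have "F \<inter> F' \<in> intersections F \<G>" using F by (auto simp: intersections_def)
    ultimately show False using unc[OF F(1)] by blast
  qed
  moreover have "?t ` \<G> \<subseteq> nsets {1..n} (card D)"
  proof (rule image_subsetI)
    fix F assume F: "F \<in> \<G>"
    then have fin: "F \<subseteq> {1..n}" "finite F" using part by (auto simp: k_partite_def nsets_def)
    have "X i \<inter> X j = {}" if "i \<in> D" "j \<in> D" "i \<noteq> j" for i j
      using part that D by (intro disjoint_family_onD[of X "{1..k}"]) (auto simp: k_partite_def)
    then have "card (\<Union>i\<in>D. F \<inter> X i) = (\<Sum>i\<in>D. card (F \<inter> X i))"
      using fin(2) \<open>finite D\<close> by (intro card_UN_disjoint) blast+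
    also have "\<dots> = card D" using one[OF F] by simp
    finally have "card (?t F) = card D" by (simp only: Int_UN_distrib)
    moreover have "finite (?t F)" using fin(2) by (rule finite_Int[OF disjI1])
    ultimately show "?t F \<in> nsets {1..n} (card D)"
      using fin(1) unfolding nsets_def by blast
  qed
  ultimately have "card \<G> \<le> card (nsets {1..n} (card D))"
    by (intro card_inj_on_le) (auto intro: finite_imp_finite_nsets)
  then show ?thesis by simp
qed

text \<open>The complement of \<open>x\<close> is uncovered, since only itself and the whole of
  \<open>{1..k}\<close> contain it. An uncovered set with at most \<open>k - 2\<close> elements
  would extend to an uncovered one with exactly \<open>k - 2\<close>, against
  \<open>cov\<close>.\<close>

lemma rank_eq_if_type1_shape:
  assumes proper: "\<And>B. B \<in> \<J> \<Longrightarrow> B \<subset> {1..k}"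
    and cov: "\<And>D. D \<subseteq> {1..k} \<Longrightarrow> card D = k - 2 \<Longrightarrow> \<exists>B\<in>\<J>. D \<subseteq> B"
    and x: "x \<in> {1..k}" "{1..k} - {x} \<notin> \<J>" and "k \<ge> 2"
  shows "rank k \<J> = k - 1"
  unfolding rank_def
proof (rule Min_eqI)
  show "finite {card D |D. D \<subseteq> {1..k} \<and> \<not> (\<exists>B\<in>\<J>. D \<subseteq> B)}"
    by (rule finite_subset[of _ "card ` Pow {1..k}"]) auto
  have unc: "\<not> {1..k} - {x} \<subseteq> B" if "B \<in> \<J>" for B
  proof
    assume "{1..k} - {x} \<subseteq> B"
    with proper[OF that] x(1) have "B = {1..k} - {x}" by blast
    with x(2) that show False by simp
  qed
  have "card ({1..k} - {x}) = k - 1" using x(1) by simp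
  with unc show "k - 1 \<in> {card D |D. D \<subseteq> {1..k} \<and> \<not> (\<exists>B\<in>\<J>. D \<subseteq> B)}"
    by (intro CollectI exI[of _ "{1..k} - {x}"]) auto
next
  fix d assume "d \<in> {card D |D. D \<subseteq> {1..k} \<and> \<not> (\<exists>B\<in>\<J>. D \<subseteq> B)}"
  then obtain D where D: "d = card D" "D \<subseteq> {1..k}" "\<not> (\<exists>B\<in>\<J>. D \<subseteq> B)" by auto
  show "k - 1 \<le> d"
  proof (rule ccontr)
    assume "\<not> k - 1 \<le> d"
    then have "card D \<le> k - 2" using D(1) by linarith
    then obtain E where "D \<subseteq> E" "E \<subseteq> {1..k}" "card E = k - 2"
      using D exists_subset_between[of D "k - 2" "{1..k}"] by auto
    with cov[of E] D(3) show False by blast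
  qed
qed

text \<open>The case split is on whether some \<open>(k - 2)\<close>-set is uncovered by
  \<open>\<J>\<close>, that is, whether the rank is at most \<open>k - 2\<close>. An uncovered set
  bounds the size; otherwise failure of type 1 yields the two singletons and thus a path.\<close>

lemma homogeneous_trichotomy:
  assumes hom: "homogeneous n k s \<G> \<J>" and ne: "\<G> \<noteq> {}"
    and k: "k \<ge> 4" and l: "l \<ge> 1" and s: "s \<ge> k * l"
  shows "card \<G> \<le> n choose (k - 2) \<or> type1 k \<J> \<or> (\<exists>\<P>\<subseteq>\<G>. linear_path k l \<P>)"
proof (cases "\<exists>D\<subseteq>{1..k}. card D = k - 2 \<and> \<not> (\<exists>B\<in>\<J>. D \<subseteq> B)")
  case True
  then obtain D where D: "D \<subseteq> {1..k}" "card D = k - 2" "\<not> (\<exists>B\<in>\<J>. D \<subseteq> B)" by blast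
  obtain X where X: "k_partite n k X \<G>" "\<forall>F\<in>\<G>. pattern k X ` intersections F \<G> = \<J>"
    using hom unfolding homogeneous_def by (elim exE conjE) (rule that)
  have "\<not> D \<subseteq> B" if "F \<in> \<G>" "B \<in> pattern k X ` intersections F \<G>" for F B
    using that X(2) D(3) by simp
  with card_le_if_uncovered[OF X(1) D(1)] D(2) show ?thesis by simp
next
  case False
  then have cov: "\<And>D. D \<subseteq> {1..k} \<Longrightarrow> card D = k - 2 \<Longrightarrow> \<exists>B\<in>\<J>. D \<subseteq> B" by blast
  obtain X where part: "k_partite n k X \<G>"
    and X: "\<forall>B\<in>\<J>. B \<subset> {1..k}" "\<forall>F\<in>\<G>. pattern k X ` intersections F \<G> = \<J>"
      "\<forall>A\<in>\<J>. \<forall>B\<in>\<J>. A \<inter> B \<in> \<J>"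
      "\<forall>F\<in>\<G>. \<forall>A\<in>intersections F \<G>. \<exists>\<S>\<subseteq>\<G>. F \<in> \<S> \<and> star s A \<S>"
    using hom unfolding homogeneous_def by (elim exE conjE) (rule that)
  note proper = X(1)[rule_format] and pat = X(2)[rule_format]
    and cl = X(3)[rule_format] and stars = X(4)[rule_format]
  show ?thesis
  proof (cases "type1 k \<J>")
    case False
    \<comment> \<open>Once one complement is missing the rank is \<open>k - 1\<close>, so type 1 can
      only fail through a second missing complement.\<close>
    have not1: "\<exists>y\<in>{1..k}. y \<noteq> x \<and> {1..k} - {y} \<notin> \<J>"
      if "x \<in> {1..k}" "{1..k} - {x} \<notin> \<J>" for x
    proof -
      have "rank k \<J> = k - 1"
        using k by (intro rank_eq_if_type1_shape[OF proper cov that]) simp_all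
      with False that show ?thesis unfolding type1_def by blast
    qed
    obtain i j where ij: "i \<in> {1..k}" "j \<in> {1..k}" "i \<noteq> j" "{i} \<in> \<J>" "{j} \<in> \<J>"
      using two_singletons_if_not_type1[OF k proper cl cov not1] by blast
    have "\<exists>\<P>\<subseteq>\<G>. linear_path k l \<P>"
    proof (rule linear_path_if_stars[of \<G> k X i j s l])
      show "X i \<inter> X j = {}"
        using part ij by (auto simp: k_partite_def disjoint_family_on_def)
      fix F assume F: "F \<in> \<G>"
      then show "finite F \<and> card F = k"
        using part by (auto simp: k_partite_def nsets_def)
      fix p assume p: "p \<in> {i, j}"
      then show "card (F \<inter> X p) = 1"
        using part F ij by (auto simp: k_partite_def)
      \<comment> \<open>By homogeneity every member realises the same pattern \<open>\<J>\<close>,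
        so the required star is available at each edge of the growing path.\<close>
      have "{p} \<in> pattern k X ` intersections F \<G>" using p ij pat[OF F] by auto
      then obtain F' where F': "pattern k X (F \<inter> F') = {p}" "F \<inter> F' \<in> intersections F \<G>"
        by (auto simp: intersections_def)
      then have "F \<inter> F' = F \<inter> X p"
        using pattern_singleton_Int[OF part F] p ij by auto
      with stars[OF F F'(2)] show "\<exists>\<S>\<subseteq>\<G>. F \<in> \<S> \<and> star s (F \<inter> X p) \<S>" by simp
    qed (use ne k l s in auto)
    then show ?thesis by simp
  qed simp
qed

section \<open>Greedy decomposition\<close>

text \<open>As long as more than \<open>N\<close> sets remain, a nonempty subfamily satisfying
  \<open>P\<close> is split off; nonemptiness makes the remainder strictly smaller. Requiring
  \<open>step\<close> for all subfamilies lets it pass to the remainder.\<close>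

lemma greedy_partition:
  fixes N :: real
  assumes "finite \<F>"
    and step: "\<And>\<H>. \<H> \<subseteq> \<F> \<Longrightarrow> real (card \<H>) > N \<Longrightarrow> \<exists>\<G>\<subseteq>\<H>. \<G> \<noteq> {} \<and> P \<G>"
  shows "\<exists>(m :: nat) \<G> \<F>\<^sub>0. \<F> = (\<Union>i\<in>{1..m}. \<G> i) \<union> \<F>\<^sub>0 \<and> disjoint_family_on \<G> {1..m} \<and>
    (\<forall>i\<in>{1..m}. \<G> i \<inter> \<F>\<^sub>0 = {}) \<and> (\<forall>i\<in>{1..m}. \<G> i \<noteq> {} \<and> P (\<G> i)) \<and> real (card \<F>\<^sub>0) \<le> N"
  using assms
proof (induction \<F> rule: finite_psubset_induct)
  case (psubset \<F>)
  show ?case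
  proof (cases "real (card \<F>) \<le> N")
    case True
    then show ?thesis
      by (intro exI[of _ 0] exI[of _ "\<lambda>_. {}"] exI[of _ \<F>]) (auto simp: disjoint_family_on_def)
  next
    case False
    then obtain \<H> where H: "\<H> \<subseteq> \<F>" "\<H> \<noteq> {}" "P \<H>" using psubset.prems[of \<F>] by auto
    have "\<F> - \<H> \<subset> \<F>" using H by auto
    moreover have "\<exists>\<G>\<subseteq>\<H>'. \<G> \<noteq> {} \<and> P \<G>" if "\<H>' \<subseteq> \<F> - \<H>" "N < real (card \<H>')" for \<H>'
      using psubset.prems[of \<H>'] that by blast
    ultimately have "\<exists>(m :: nat) \<G> \<F>\<^sub>0. \<F> - \<H> = (\<Union>i\<in>{1..m}. \<G> i) \<union> \<F>\<^sub>0 \<and> disjoint_family_on \<G> {1..m} \<and>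
        (\<forall>i\<in>{1..m}. \<G> i \<inter> \<F>\<^sub>0 = {}) \<and> (\<forall>i\<in>{1..m}. \<G> i \<noteq> {} \<and> P (\<G> i)) \<and> real (card \<F>\<^sub>0) \<le> N"
      by (rule psubset.IH)
    then
    obtain m :: nat and \<G> \<F>\<^sub>0 where IH: "\<F> - \<H> = (\<Union>i\<in>{1..m}. \<G> i) \<union> \<F>\<^sub>0"
      "disjoint_family_on \<G> {1..m}" "\<forall>i\<in>{1..m}. \<G> i \<inter> \<F>\<^sub>0 = {}"
      "\<forall>i\<in>{1..m}. \<G> i \<noteq> {} \<and> P (\<G> i)" "real (card \<F>\<^sub>0) \<le> N"
      by (elim exE conjE) (rule that)
    \<comment> \<open>The piece split off first receives the last index, so the pieces of the
      remainder keep theirs.\<close>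
    let ?G = "\<G>(Suc m := \<H>)"
    have old: "?G i = \<G> i" if "i \<in> {1..m}" for i using that by auto
    have ins: "{1..Suc m} = insert (Suc m) {1..m}" by auto
    have Un: "(\<Union>i\<in>{1..Suc m}. ?G i) = \<H> \<union> (\<Union>i\<in>{1..m}. \<G> i)"
      unfolding ins using old by auto
    have out: "\<G> i \<inter> \<H> = {}" if "i \<in> {1..m}" for i using IH(1) that by blast
    have "\<F> = (\<Union>i\<in>{1..Suc m}. ?G i) \<union> \<F>\<^sub>0"
      unfolding Un using IH(1) H(1) by blast
    moreover have "disjoint_family_on ?G {1..Suc m}"
      using IH(2) out unfolding ins disjoint_family_on_def by (auto simp: Int_commute)
    moreover have "\<forall>i\<in>{1..Suc m}. ?G i \<inter> \<F>\<^sub>0 = {}"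
      using IH(1,3) unfolding ins by auto
    moreover have "\<forall>i\<in>{1..Suc m}. ?G i \<noteq> {} \<and> P (?G i)"
      using IH(4) H unfolding ins by auto
    ultimately show ?thesis using IH(5) by blast
  qed
qed

theorem theorem3p9:
  fixes k l s n :: nat and c :: real and \<F> :: "nat set set"
  assumes "k \<ge> 4" and "l > 0" and "s > 0" and "s \<ge> k * l"
    and "c > 0"
    and "\<forall>N. \<forall>\<G> \<subseteq> nsets {1..N} k. \<exists>\<G>' \<subseteq> \<G>.
           (\<exists>\<J>. homogeneous N k s \<G>' \<J>) \<and> real (card \<G>') \<ge> c * real (card \<G>)"
    and "\<F> \<subseteq> nsets {1..n} k"
    and "\<not> (\<exists>\<P> :: nat set set. linear_path k l \<P> \<and> contains_copy \<F> \<P>)"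
  shows "\<exists>(m :: nat) (\<G> :: nat \<Rightarrow> nat set set) \<F>\<^sub>0.
           \<F> = (\<Union>i\<in>{1..m}. \<G> i) \<union> \<F>\<^sub>0 \<and>
           disjoint_family_on \<G> {1..m} \<and>
           (\<forall>i\<in>{1..m}. \<G> i \<inter> \<F>\<^sub>0 = {}) \<and>
           (\<forall>i\<in>{1..m}. \<G> i \<noteq> {} \<and>
              (\<exists>\<J>. homogeneous n k s (\<G> i) \<J> \<and> rank k \<J> = k - 1 \<and> type1 k \<J>)) \<and>
           real (card \<F>\<^sub>0) \<le> 1 / c * real (n choose (k - 2))"
proof (rule greedy_partition)
  show "finite \<F>"
    using assms(7) finite_subset finite_imp_finite_nsets by blast
  fix \<H> assume H: "\<H> \<subseteq> \<F>" "real (card \<H>) > 1 / c * real (n choose (k - 2))"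
  then obtain \<G> \<J> where G: "\<G> \<subseteq> \<H>" "homogeneous n k s \<G> \<J>" "real (card \<G>) \<ge> c * real (card \<H>)"
    using assms(6,7) by (meson order_trans)
  \<comment> \<open>The threshold \<open>1 / c * real (n choose (k - 2))\<close> is chosen so that
    even after the loss of the factor \<open>c\<close> the homogeneous subfamily is too large for
    the first alternative of the trichotomy.\<close>
  have "c * real (card \<H>) > real (n choose (k - 2))"
    using H(2) \<open>c > 0\<close> by (simp add: field_simps)
  with G(3) have big: "card \<G> > n choose (k - 2)" by linarith
  then have "\<G> \<noteq> {}" by auto
  \<comment> \<open>A linear path inside the family is a copy of itself, via the identity.\<close>
  moreover have "\<not> (\<exists>\<P>\<subseteq>\<G>. linear_path k l \<P>)"
    using assms(8) contains_copy_subset G(1) H(1) by (meson order_trans)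
  ultimately have "type1 k \<J>"
    using homogeneous_trichotomy[OF G(2), of l] assms(1,2,4) big by force
  then show "\<exists>\<G>\<subseteq>\<H>. \<G> \<noteq> {} \<and>
      (\<exists>\<J>. homogeneous n k s \<G> \<J> \<and> rank k \<J> = k - 1 \<and> type1 k \<J>)"
    using G \<open>\<G> \<noteq> {}\<close> unfolding type1_def by blast
qed

end
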